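(* For every constant $\gamma\in(0,1)$ there is a constant $a=a(\gamma)>0$ such that for every integer $n>0$ and every integer $k$ with $1\le k\le 2^{\gamma n}$, every quantum learner that exactly learns the class of $k$-Fourier-sparse Boolean functions $f:\{0,1\}^n\to\{-1,1\}$ with success probability at least $2/3$ uses at least $a\,k\log k$ uniform quantum examples. (That is, $\Omega(k\log k)$ uniform quantum examples are necessary.)
   Context: Logarithms are base 2. For $f:\{0,1\}^n\to\mathbb{R}$ and $S\in\{0,1\}^n$, the Fourier coefficient is $\widehat f(S)=2^{-n}\sum_{x\in\{0,1\}^n} f(x)(-1)^{S\cdot x}$. A function $f:\{0,1\}^n\to\{-1,1\}$ is $k$-Fourier-sparse if $\widehat f(S)\neq 0$ for at most $k$ different $S$. A uniform quantum example for $c:\{0,1\}^n\to\{-1,1\}$ is the $(n+1)$-qubit state $|\psi_c\rangle=\frac{1}{\sqrt{2^n}}\sum_{x\in\{0,1\}^n}|x,c(x)\rangle$, where $\{|x,b\rangle : x\in\{0,1\}^n,\ b\in\{-1,1\}\}$ is an orthonormal basis. A quantum learner using $T$ uniform quantum examples is a quantum measurement (POVM) applied to $|\psi_c\rangle^{\otimes T}$, not depending on $c$, whose outcome is a function $h:\{0,1\}^n\to\{-1,1\}$. It exactly learns a class $\mathcal{C}$ with success probability at least $p$ if for every $c\in\mathcal{C}$ the outcome equals $c$ with probability at least $p$. *)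

theory Defs
  imports Complex_Main "HOL-Library.FuncSet" "HOL-Library.Nonpos_Ints"
begin

definition cube :: "nat \<Rightarrow> (nat \<Rightarrow> nat) set" where
  "cube n = {..<n} \<rightarrow>\<^sub>E {0, 1}"

definition bool_funs :: "nat \<Rightarrow> ((nat \<Rightarrow> nat) \<Rightarrow> real) set" where
  "bool_funs n = cube n \<rightarrow>\<^sub>E {-1, 1}"

definition fourier_coeff :: "nat \<Rightarrow> ((nat \<Rightarrow> nat) \<Rightarrow> real) \<Rightarrow> (nat \<Rightarrow> nat) \<Rightarrow> real" where
  "fourier_coeff n f S = (1 / 2 ^ n) * (\<Sum>x\<in>cube n. f x * (-1) ^ (\<Sum>i<n. S i * x i))"

definition fourier_sparse :: "nat \<Rightarrow> nat \<Rightarrow> ((nat \<Rightarrow> nat) \<Rightarrow> real) set" where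
  "fourier_sparse n k = {f \<in> bool_funs n. card {S \<in> cube n. fourier_coeff n f S \<noteq> 0} \<le> k}"

text \<open>
  The Hilbert space with orthonormal basis \<open>I\<close> (a finite set) is represented in coordinates:
  vectors are functions \<open>v :: 'i \<Rightarrow> complex\<close> and operators are matrices \<open>A :: 'i \<Rightarrow> 'i \<Rightarrow> complex\<close>,
  of which only the values on \<open>I\<close> matter.
\<close>

definition qform :: "'i set \<Rightarrow> ('i \<Rightarrow> 'i \<Rightarrow> complex) \<Rightarrow> ('i \<Rightarrow> complex) \<Rightarrow> complex" where
  "qform I A v = (\<Sum>i\<in>I. \<Sum>j\<in>I. cnj (v i) * A i j * v j)"

text \<open>Over the complex numbers, a nonnegative real quadratic form already forces \<open>A\<close> to be Hermitian.\<close>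

definition psd_on :: "'i set \<Rightarrow> ('i \<Rightarrow> 'i \<Rightarrow> complex) \<Rightarrow> bool" where
  "psd_on I A \<longleftrightarrow> (\<forall>v. qform I A v \<in> \<real>\<^sub>\<ge>\<^sub>0)"

definition povm :: "'i set \<Rightarrow> 'h set \<Rightarrow> ('h \<Rightarrow> 'i \<Rightarrow> 'i \<Rightarrow> complex) \<Rightarrow> bool" where
  "povm I H E \<longleftrightarrow>
     (\<forall>h\<in>H. psd_on I (E h)) \<and>
     (\<forall>i\<in>I. \<forall>j\<in>I. (\<Sum>h\<in>H. E h i j) = (if i = j then 1 else 0))"

definition outcome_prob ::
    "'i set \<Rightarrow> ('h \<Rightarrow> 'i \<Rightarrow> 'i \<Rightarrow> complex) \<Rightarrow> ('i \<Rightarrow> complex) \<Rightarrow> 'h \<Rightarrow> real" where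
  "outcome_prob I E v h = Re (qform I (E h) v)"

definition ket :: "'i \<Rightarrow> 'i \<Rightarrow> complex" where
  "ket e = (\<lambda>i. if i = e then 1 else 0)"

type_synonym example_label = "(nat \<Rightarrow> nat) \<times> real"

definition example_basis :: "nat \<Rightarrow> example_label set" where
  "example_basis n = cube n \<times> {-1, 1}"

definition quantum_example ::
    "nat \<Rightarrow> ((nat \<Rightarrow> nat) \<Rightarrow> real) \<Rightarrow> example_label \<Rightarrow> complex" where
  "quantum_example n c = (\<lambda>e. of_real (1 / sqrt (2 ^ n)) * (\<Sum>x\<in>cube n. ket (x, c x) e))"

text \<open>
  The product basis of a \<open>T\<close>-fold tensor power consists of the \<open>T\<close>-tuples of basis labels, and
  the coordinates of \<open>v \<otimes> \<dots> \<otimes> v\<close> are the products of the coordinates of \<open>v\<close>.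
\<close>

definition tensor_basis :: "nat \<Rightarrow> 'i set \<Rightarrow> (nat \<Rightarrow> 'i) set" where
  "tensor_basis T I = {..<T} \<rightarrow>\<^sub>E I"

definition tensor_power :: "nat \<Rightarrow> ('i \<Rightarrow> complex) \<Rightarrow> (nat \<Rightarrow> 'i) \<Rightarrow> complex" where
  "tensor_power T v = (\<lambda>w. \<Prod>t<T. v (w t))"

type_synonym measurement =
  "((nat \<Rightarrow> nat) \<Rightarrow> real) \<Rightarrow> (nat \<Rightarrow> example_label) \<Rightarrow> (nat \<Rightarrow> example_label) \<Rightarrow> complex"

definition quantum_learner :: "nat \<Rightarrow> nat \<Rightarrow> measurement \<Rightarrow> bool" where
  "quantum_learner n T E \<longleftrightarrow> povm (tensor_basis T (example_basis n)) (bool_funs n) E"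

definition exactly_learns ::
    "nat \<Rightarrow> nat \<Rightarrow> measurement \<Rightarrow> ((nat \<Rightarrow> nat) \<Rightarrow> real) set \<Rightarrow> real \<Rightarrow> bool" where
  "exactly_learns n T E C p \<longleftrightarrow>
     (\<forall>c\<in>C. outcome_prob (tensor_basis T (example_basis n)) E
               (tensor_power T (quantum_example n c)) c \<ge> p)"

end

theory Submission imports Defs begin

text \<open>
  For \<open>2^d \<le> k < 2^(d+1)\<close> consider the functions that are \<open>-1\<close> on the graph of a linear map
  \<open>GF(2)^(n-d) \<rightarrow> GF(2)^d\<close> and \<open>1\<close> elsewhere. There are \<open>2^(d(n-d))\<close> of them, each has Fourier
  support of size at most \<open>2^d\<close>, and all have zeroth coefficient \<open>1 - 2/2^d\<close>. Hence their uniform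
  examples agree up to a component of squared norm at most \<open>2/2^d\<close>. Expand \<open>T\<close> copies in an
  orthonormal product basis whose first letter is the common part. By Markov's inequality, words
  with more than \<open>m\<close> other letters carry squared norm at most \<open>2T/(2^d(m+1))\<close>, while the remaining
  words span a space of dimension at most \<open>(1 + T 2^n)^m\<close>. A measurement cannot identify many more
  states than the dimension of the space that approximately contains them. Taking \<open>m\<close> a small
  multiple of \<open>d\<close> makes this dimension at most half the number of functions, so the neglected part
  must be large, which forces \<open>T\<close> to be of order \<open>d 2^d\<close>.
\<close>

section \<open>Measurements and quadratic forms\<close>

text \<open>Real part of the sesquilinear form: bilinear over the reals, which suffices because all
  decompositions below have real coefficients.\<close>

definition bform :: "'i set \<Rightarrow> ('i \<Rightarrow> 'i \<Rightarrow> complex) \<Rightarrow> ('i \<Rightarrow> complex) \<Rightarrow> ('i \<Rightarrow> complex) \<Rightarrow> real" where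
  "bform I A u v = Re (\<Sum>i\<in>I. \<Sum>j\<in>I. cnj (u i) * A i j * v j)"

lemma Re_qform: "Re (qform I A v) = bform I A v v"
  by (simp add: qform_def bform_def)

lemma bform_nonneg:
  assumes "psd_on I A"
  shows "0 \<le> bform I A v v"
  using assms unfolding psd_on_def Re_qform[symmetric]
  by (metis Re_complex_of_real nonneg_Reals_cases of_real_0)

lemma bform_add_left: "bform I A (\<lambda>i. u i + u' i) v = bform I A u v + bform I A u' v"
  by (simp add: bform_def algebra_simps sum.distrib)

lemma bform_add_right: "bform I A u (\<lambda>i. v i + v' i) = bform I A u v + bform I A u v'"
  by (simp add: bform_def algebra_simps sum.distrib)

lemma bform_scale_left: "bform I A (\<lambda>i. complex_of_real a * u i) v = a * bform I A u v"
proof -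
  have "(\<Sum>i\<in>I. \<Sum>j\<in>I. cnj (complex_of_real a * u i) * A i j * v j) =
     complex_of_real a * (\<Sum>i\<in>I. \<Sum>j\<in>I. cnj (u i) * A i j * v j)"
    by (simp add: sum_distrib_left mult_ac)
  then show ?thesis by (simp add: bform_def)
qed

lemma bform_scale_right: "bform I A u (\<lambda>i. complex_of_real a * v i) = a * bform I A u v"
proof -
  have "(\<Sum>i\<in>I. \<Sum>j\<in>I. cnj (u i) * A i j * (complex_of_real a * v j)) =
     complex_of_real a * (\<Sum>i\<in>I. \<Sum>j\<in>I. cnj (u i) * A i j * v j)"
    by (simp add: sum_distrib_left mult_ac)
  then show ?thesis by (simp add: bform_def)
qed

lemma bform_zero [simp]: "bform I A (\<lambda>i. 0) v = 0" "bform I A u (\<lambda>i. 0) = 0"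
  by (simp_all add: bform_def)

lemma bform_sum_left:
  "finite W \<Longrightarrow> bform I A (\<lambda>i. \<Sum>w\<in>W. u w i) v = (\<Sum>w\<in>W. bform I A (u w) v)"
  by (induction W rule: finite_induct) (simp_all add: bform_add_left)

lemma bform_sum_right:
  "finite W \<Longrightarrow> bform I A u (\<lambda>i. \<Sum>w\<in>W. v w i) = (\<Sum>w\<in>W. bform I A u (v w))"
  by (induction W rule: finite_induct) (simp_all add: bform_add_right)

text \<open>The cross terms stay together as one sum, so positivity applies directly without first
  deriving that \<open>A\<close> is Hermitian.\<close>

lemma bform_combination:
  "bform I A (\<lambda>i. of_real a * u i + of_real b * v i) (\<lambda>i. of_real a * u i + of_real b * v i) =
     a\<^sup>2 * bform I A u u + b\<^sup>2 * bform I A v v + a * b * (bform I A u v + bform I A v u)"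
  by (simp add: bform_add_left bform_add_right bform_scale_left bform_scale_right
      power2_eq_square algebra_simps)

text \<open>Positivity at \<open>u - 10 v\<close> bounds the cross terms by a tenth of the form at
  \<open>u\<close> plus ten times the form at \<open>v\<close>. The weights are lopsided because
  \<open>u\<close> will be the main part and needs a factor near 1, while \<open>v\<close> will be
  the small neglected part.\<close>

lemma bform_add_le:
  assumes "psd_on I A"
  shows "bform I A (\<lambda>i. u i + v i) (\<lambda>i. u i + v i) \<le> 11/10 * bform I A u u + 11 * bform I A v v"
proof -
  have "0 \<le> bform I A (\<lambda>i. of_real 1 * u i + of_real (-10) * v i)
                      (\<lambda>i. of_real 1 * u i + of_real (-10) * v i)"
    by (rule bform_nonneg[OF assms])
  moreover have "bform I A (\<lambda>i. u i + v i) (\<lambda>i. u i + v i) =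
      bform I A u u + bform I A v v + (bform I A u v + bform I A v u)"
    using bform_combination[of I A 1 u 1 v] by simp
  ultimately show ?thesis
    unfolding bform_combination by simp
qed

text \<open>Cauchy--Schwarz in the form of Lagrange's identity: the difference of the two sides is half the
  sum of the form over the vectors \<open>\<alpha> w' e w - \<alpha> w e w'\<close>.\<close>

lemma bform_sum_le:
  fixes \<alpha> :: "'w \<Rightarrow> real"
  assumes "psd_on I A" and fin: "finite W"
  shows "bform I A (\<lambda>i. \<Sum>w\<in>W. of_real (\<alpha> w) * e w i) (\<lambda>i. \<Sum>w\<in>W. of_real (\<alpha> w) * e w i)
           \<le> (\<Sum>w\<in>W. (\<alpha> w)\<^sup>2) * (\<Sum>w\<in>W. bform I A (e w) (e w))"
proof -
  let ?B = "\<lambda>w w'. bform I A (e w) (e w')"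
  let ?X = "\<Sum>w\<in>W. \<Sum>w'\<in>W. \<alpha> w * \<alpha> w' * ?B w w'"
  have X: "bform I A (\<lambda>i. \<Sum>w\<in>W. of_real (\<alpha> w) * e w i) (\<lambda>i. \<Sum>w\<in>W. of_real (\<alpha> w) * e w i) = ?X"
    by (simp add: bform_sum_left[OF fin] bform_sum_right[OF fin] bform_scale_left
        bform_scale_right sum_distrib_left mult_ac)
  have "0 \<le> (\<Sum>w\<in>W. \<Sum>w'\<in>W.
      bform I A (\<lambda>i. of_real (\<alpha> w') * e w i + of_real (- \<alpha> w) * e w' i)
                (\<lambda>i. of_real (\<alpha> w') * e w i + of_real (- \<alpha> w) * e w' i))"
    by (intro sum_nonneg bform_nonneg assms)
  also have "\<dots> = (\<Sum>w\<in>W. \<Sum>w'\<in>W. (\<alpha> w')\<^sup>2 * ?B w w) + (\<Sum>w\<in>W. \<Sum>w'\<in>W. (\<alpha> w)\<^sup>2 * ?B w' w')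
      - ?X - (\<Sum>w\<in>W. \<Sum>w'\<in>W. \<alpha> w' * \<alpha> w * ?B w' w)"
    unfolding bform_combination
    by (simp add: sum.distrib sum_subtractf algebra_simps sum_negf)
  also have "(\<Sum>w\<in>W. \<Sum>w'\<in>W. \<alpha> w' * \<alpha> w * ?B w' w) = ?X"
    by (rule sum.swap)
  also have "(\<Sum>w\<in>W. \<Sum>w'\<in>W. (\<alpha> w)\<^sup>2 * ?B w' w') = (\<Sum>w\<in>W. (\<alpha> w)\<^sup>2) * (\<Sum>w\<in>W. ?B w w)"
    by (simp add: sum_product)
  also have "(\<Sum>w\<in>W. \<Sum>w'\<in>W. (\<alpha> w')\<^sup>2 * ?B w w) = (\<Sum>w\<in>W. (\<alpha> w)\<^sup>2) * (\<Sum>w\<in>W. ?B w w)"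
    by (subst sum.swap) (simp add: sum_product)
  finally show ?thesis unfolding X by simp
qed

section \<open>Total success probability of a measurement\<close>

lemma povm_sum_bform:
  assumes "povm I H E" "finite I"
  shows "(\<Sum>h\<in>H. bform I (E h) v v) = (\<Sum>i\<in>I. (cmod (v i))\<^sup>2)"
proof -
  have "(\<Sum>h\<in>H. \<Sum>i\<in>I. \<Sum>j\<in>I. cnj (v i) * E h i j * v j) =
        (\<Sum>i\<in>I. \<Sum>j\<in>I. cnj (v i) * (\<Sum>h\<in>H. E h i j) * v j)"
    by (subst sum.swap, rule sum.cong[OF refl], subst sum.swap)
      (simp add: sum_distrib_left sum_distrib_right)
  also have "\<dots> = (\<Sum>i\<in>I. \<Sum>j\<in>I. if i = j then cnj (v i) * v j else 0)"
    using assms by (intro sum.cong refl) (auto simp: povm_def)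
  also have "\<dots> = (\<Sum>i\<in>I. complex_of_real ((cmod (v i))\<^sup>2))"
    using assms(2) by (simp add: complex_norm_square mult.commute del: of_real_power)
  finally show ?thesis
    unfolding bform_def Re_sum[symmetric] by (simp del: of_real_power Re_sum flip: of_real_sum)
qed

text \<open>The quantitative form of the dimension bound: the approximating vectors
  \<open>e w\<close> are shared by all concepts, and by completeness each contributes at most its
  squared norm to the total over all outcomes. The remainder costs at most \<open>11 * t\<close> per
  concept.\<close>

lemma sum_outcome_prob_le:
  fixes \<alpha> :: "'h \<Rightarrow> 'w \<Rightarrow> real"
  assumes povm: "povm I H E" and fin: "finite I" "finite H" "finite W" and "C \<subseteq> H"
    and dec: "\<And>c i. c \<in> C \<Longrightarrow> i \<in> I \<Longrightarrow> \<psi> c i = (\<Sum>w\<in>W. of_real (\<alpha> c w) * e w i) + r c i"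
    and \<alpha>: "\<And>c. c \<in> C \<Longrightarrow> (\<Sum>w\<in>W. (\<alpha> c w)\<^sup>2) \<le> 1"
    and e: "\<And>w. w \<in> W \<Longrightarrow> (\<Sum>i\<in>I. (cmod (e w i))\<^sup>2) \<le> 1"
    and r: "\<And>c. c \<in> C \<Longrightarrow> (\<Sum>i\<in>I. (cmod (r c i))\<^sup>2) \<le> t"
  shows "(\<Sum>c\<in>C. outcome_prob I E (\<psi> c) c) \<le> 11/10 * real (card W) + 11 * t * real (card C)"
proof -
  have psd: "psd_on I (E h)" if "h \<in> H" for h
    using povm that by (auto simp: povm_def)
  have le: "outcome_prob I E (\<psi> c) c
      \<le> 11/10 * (\<Sum>w\<in>W. bform I (E c) (e w) (e w)) + 11 * t" if c: "c \<in> C" for c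
  proof -
    let ?u = "\<lambda>i. \<Sum>w\<in>W. of_real (\<alpha> c w) * e w i"
    have cH: "c \<in> H" using c \<open>C \<subseteq> H\<close> by auto
    have "outcome_prob I E (\<psi> c) c = bform I (E c) (\<lambda>i. ?u i + r c i) (\<lambda>i. ?u i + r c i)"
      unfolding outcome_prob_def Re_qform
      by (simp add: bform_def dec[OF c] cong: sum.cong)
    also have "\<dots> \<le> 11/10 * bform I (E c) ?u ?u + 11 * bform I (E c) (r c) (r c)"
      by (rule bform_add_le[OF psd[OF cH]])
    \<comment> \<open>One outcome is bounded by all outcomes together, which give the squared norm
      of the remainder.\<close>
    also have "bform I (E c) (r c) (r c) \<le> (\<Sum>h\<in>H. bform I (E h) (r c) (r c))"
      by (rule member_le_sum) (use cH fin psd in \<open>auto intro: bform_nonneg\<close>)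
    also have "\<dots> \<le> t"
      using povm_sum_bform[OF povm fin(1)] r[OF c] by simp
    also have "bform I (E c) ?u ?u \<le> (\<Sum>w\<in>W. (\<alpha> c w)\<^sup>2) * (\<Sum>w\<in>W. bform I (E c) (e w) (e w))"
      by (rule bform_sum_le[OF psd[OF cH] fin(3)])
    also have "\<dots> \<le> 1 * (\<Sum>w\<in>W. bform I (E c) (e w) (e w))"
      by (intro mult_right_mono \<alpha>[OF c] sum_nonneg bform_nonneg psd cH)
    finally show ?thesis by simp
  qed
  have "(\<Sum>c\<in>C. \<Sum>w\<in>W. bform I (E c) (e w) (e w)) \<le> (\<Sum>h\<in>H. \<Sum>w\<in>W. bform I (E h) (e w) (e w))"
    by (rule sum_mono2) (use fin \<open>C \<subseteq> H\<close> psd in \<open>auto intro!: sum_nonneg bform_nonneg\<close>)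
  also have "\<dots> = (\<Sum>w\<in>W. \<Sum>h\<in>H. bform I (E h) (e w) (e w))"
    by (rule sum.swap)
  also have "\<dots> \<le> (\<Sum>w\<in>W. 1)"
    by (intro sum_mono) (use povm_sum_bform[OF povm fin(1)] e in simp)
  finally have D: "(\<Sum>c\<in>C. \<Sum>w\<in>W. bform I (E c) (e w) (e w)) \<le> real (card W)"
    by simp
  have "(\<Sum>c\<in>C. outcome_prob I E (\<psi> c) c)
      \<le> (\<Sum>c\<in>C. 11/10 * (\<Sum>w\<in>W. bform I (E c) (e w) (e w)) + 11 * t)"
    by (rule sum_mono) (rule le)
  also have "\<dots> = 11/10 * (\<Sum>c\<in>C. \<Sum>w\<in>W. bform I (E c) (e w) (e w)) + 11 * t * real (card C)"
    by (simp only: sum.distrib sum_distrib_left[symmetric]) simp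
  finally show ?thesis using D by simp
qed

section \<open>Tensor powers\<close>

lemma sum_PiE_prod:
  fixes f :: "nat \<Rightarrow> 'l \<Rightarrow> 'a :: comm_semiring_1"
  assumes "finite L"
  shows "(\<Sum>s\<in>{..<T} \<rightarrow>\<^sub>E L. \<Prod>t<T. f t (s t)) = (\<Prod>t<T. \<Sum>l\<in>L. f t l)"
  using assms by (simp add: prod_sum_PiE)

lemma orthonormal_sum_norm:
  fixes e :: "'w \<Rightarrow> 'i \<Rightarrow> real"
  assumes "finite W"
    and on: "\<And>w w'. w \<in> W \<Longrightarrow> w' \<in> W \<Longrightarrow> (\<Sum>i\<in>I. e w i * e w' i) = (if w = w' then 1 else 0)"
  shows "(\<Sum>i\<in>I. (\<Sum>w\<in>W. \<alpha> w * e w i)\<^sup>2) = (\<Sum>w\<in>W. (\<alpha> w)\<^sup>2)"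
proof -
  have "(\<Sum>i\<in>I. (\<Sum>w\<in>W. \<alpha> w * e w i)\<^sup>2) =
        (\<Sum>i\<in>I. \<Sum>w\<in>W. \<Sum>w'\<in>W. \<alpha> w * \<alpha> w' * (e w i * e w' i))"
    by (simp add: power2_eq_square sum_product mult_ac)
  also have "\<dots> = (\<Sum>w\<in>W. \<Sum>w'\<in>W. \<alpha> w * \<alpha> w' * (\<Sum>i\<in>I. e w i * e w' i))"
    by (subst sum.swap, rule sum.cong[OF refl], subst sum.swap) (simp add: sum_distrib_left)
  also have "\<dots> = (\<Sum>w\<in>W. \<Sum>w'\<in>W. if w = w' then \<alpha> w * \<alpha> w' else 0)"
    by (intro sum.cong refl) (simp add: on)
  finally show ?thesis
    using \<open>finite W\<close> by (simp add: power2_eq_square)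
qed

text \<open>The inner product factorises over positions, and distinct words contribute a zero factor
  at a position where they differ.\<close>

lemma tensor_orthonormal:
  fixes e :: "'l \<Rightarrow> 'i \<Rightarrow> real"
  assumes "finite I"
    and on: "\<And>l l'. l \<in> L \<Longrightarrow> l' \<in> L \<Longrightarrow> (\<Sum>i\<in>I. e l i * e l' i) = (if l = l' then 1 else 0)"
    and s: "s \<in> {..<T} \<rightarrow>\<^sub>E L" "s' \<in> {..<T} \<rightarrow>\<^sub>E L"
  shows "(\<Sum>w\<in>tensor_basis T I. (\<Prod>t<T. e (s t) (w t)) * (\<Prod>t<T. e (s' t) (w t))) =
         (if s = s' then 1 else 0)"
proof -
  have "(\<Sum>w\<in>tensor_basis T I. (\<Prod>t<T. e (s t) (w t)) * (\<Prod>t<T. e (s' t) (w t))) =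
        (\<Prod>t<T. \<Sum>i\<in>I. e (s t) i * e (s' t) i)"
    unfolding tensor_basis_def prod.distrib[symmetric]
    by (rule sum_PiE_prod[OF \<open>finite I\<close>, of "\<lambda>t i. e (s t) i * e (s' t) i" T])
  also have "\<dots> = (\<Prod>t<T. if s t = s' t then 1 else 0)"
    using s by (intro prod.cong refl on) (auto simp: PiE_iff)
  also have "\<dots> = (if s = s' then 1 else 0)"
  proof (cases "s = s'")
    case False
    then have "\<exists>t<T. s t \<noteq> s' t"
      using PiE_ext[OF s] by auto
    then show ?thesis
      using False by auto
  qed simp
  finally show ?thesis .
qed

lemma tensor_power_expansion:
  assumes "finite L" "w \<in> tensor_basis T I"
    and "\<And>i. i \<in> I \<Longrightarrow> v i = of_real (\<Sum>l\<in>L. \<beta> l * e l i)"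
  shows "tensor_power T v w =
         of_real (\<Sum>s\<in>{..<T} \<rightarrow>\<^sub>E L. (\<Prod>t<T. \<beta> (s t)) * (\<Prod>t<T. e (s t) (w t)))"
proof -
  have "tensor_power T v w = of_real (\<Prod>t<T. \<Sum>l\<in>L. \<beta> l * e l (w t))"
    unfolding tensor_power_def of_real_prod
    by (rule prod.cong[OF refl], rule assms(3)) (use assms(2) in \<open>auto simp: tensor_basis_def\<close>)
  also have "(\<Prod>t<T. \<Sum>l\<in>L. \<beta> l * e l (w t)) =
             (\<Sum>s\<in>{..<T} \<rightarrow>\<^sub>E L. \<Prod>t<T. \<beta> (s t) * e (s t) (w t))"
    using sum_PiE_prod[OF \<open>finite L\<close>, of "\<lambda>t l. \<beta> l * e l (w t)" T] by simp
  finally show ?thesis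
    by (simp add: prod.distrib)
qed

section \<open>Words with few letters other than the distinguished one\<close>

definition weight :: "'l \<Rightarrow> nat \<Rightarrow> (nat \<Rightarrow> 'l) \<Rightarrow> nat" where
  "weight l0 T s = card {t \<in> {..<T}. s t \<noteq> l0}"

text \<open>Resetting one deviating position to \<open>l0\<close> lowers the weight by one. Hence a
  word of weight at most \<open>m + 1\<close> either has weight at most \<open>m\<close> or arises
  from such a word by choosing a position and a letter, a factor \<open>1 + T * card L\<close> per
  step.\<close>

lemma card_weight_le:
  assumes "finite L" "l0 \<in> L"
  shows "card {s \<in> {..<T} \<rightarrow>\<^sub>E L. weight l0 T s \<le> m} \<le> (1 + T * card L) ^ m"
proof (induction m)
  case 0
  have "{s \<in> {..<T} \<rightarrow>\<^sub>E L. weight l0 T s \<le> 0} \<subseteq> {\<lambda>t\<in>{..<T}. l0}"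
    by (auto simp: weight_def fun_eq_iff PiE_iff extensional_def)
  from card_mono[OF _ this] show ?case by simp
next
  case (Suc m)
  let ?S = "\<lambda>m. {s \<in> {..<T} \<rightarrow>\<^sub>E L. weight l0 T s \<le> m}"
  let ?upd = "\<lambda>(s, t, l). s(t := l)"
  have fin: "finite (?S m)" for m
    by (rule finite_subset[of _ "{..<T} \<rightarrow>\<^sub>E L"]) (use assms(1) in \<open>auto intro: finite_PiE\<close>)
  have "?S (Suc m) \<subseteq> ?S m \<union> ?upd ` (?S m \<times> {..<T} \<times> L)"
  proof
    fix s assume s: "s \<in> ?S (Suc m)"
    show "s \<in> ?S m \<union> ?upd ` (?S m \<times> {..<T} \<times> L)"
    proof (cases "weight l0 T s \<le> m")
      case False
      then have "{t \<in> {..<T}. s t \<noteq> l0} \<noteq> {}"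
        unfolding weight_def by (metis card.empty le0)
      then obtain t where t: "t < T" "s t \<noteq> l0" by auto
      have "{t' \<in> {..<T}. (s(t := l0)) t' \<noteq> l0} = {t' \<in> {..<T}. s t' \<noteq> l0} - {t}"
        by auto
      then have "weight l0 T (s(t := l0)) = weight l0 T s - 1"
        using t by (simp add: weight_def)
      then have "s(t := l0) \<in> ?S m"
        using s t assms(2) by (auto simp: PiE_iff extensional_def)
      moreover have "s = ?upd (s(t := l0), t, s t)" by simp
      moreover have "s t \<in> L" using s t by (auto simp: PiE_iff)
      ultimately show ?thesis using t by blast
    qed (use s in auto)
  qed
  then have "card (?S (Suc m)) \<le> card (?S m \<union> ?upd ` (?S m \<times> {..<T} \<times> L))"
    by (rule card_mono[rotated]) (use fin assms(1) in auto)
  also have "\<dots> \<le> card (?S m) + card (?upd ` (?S m \<times> {..<T} \<times> L))"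
    by (rule card_Un_le)
  also have "card (?upd ` (?S m \<times> {..<T} \<times> L)) \<le> card (?S m \<times> {..<T} \<times> L)"
    by (rule card_image_le) (use fin assms(1) in auto)
  also have "card (?S m) + card (?S m \<times> {..<T} \<times> L) = card (?S m) * (1 + T * card L)"
    by (simp add: card_cartesian_product algebra_simps)
  also have "\<dots> \<le> (1 + T * card L) ^ m * (1 + T * card L)"
    by (rule mult_right_mono[OF Suc.IH]) simp
  finally show ?case by (simp add: mult.commute)
qed

text \<open>Markov's inequality for the weight of a word of independent letters with distribution \<open>p\<close>.\<close>

lemma weight_tail:
  fixes p :: "'l \<Rightarrow> real"
  assumes "finite L" "l0 \<in> L" and p: "\<And>l. l \<in> L \<Longrightarrow> p l \<ge> 0" "(\<Sum>l\<in>L. p l) = 1"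
    and \<epsilon>: "1 - p l0 \<le> \<epsilon>"
  shows "(\<Sum>s | s \<in> {..<T} \<rightarrow>\<^sub>E L \<and> weight l0 T s > m. \<Prod>t<T. p (s t)) \<le> real T * \<epsilon> / (real m + 1)"
proof -
  let ?P = "\<lambda>s. \<Prod>t<T. p (s t)"
  have P: "?P s \<ge> 0" if "s \<in> {..<T} \<rightarrow>\<^sub>E L" for s
    using that by (intro prod_nonneg) (auto intro!: p)
  have "(\<Sum>s | s \<in> {..<T} \<rightarrow>\<^sub>E L \<and> weight l0 T s > m. ?P s) * (real m + 1)
      = (\<Sum>s | s \<in> {..<T} \<rightarrow>\<^sub>E L \<and> weight l0 T s > m. ?P s * (real m + 1))"
    by (rule sum_distrib_right)
  \<comment> \<open>For natural numbers, weight above \<open>m\<close> means weight at least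
    \<open>m + 1\<close>.\<close>
  also have "\<dots> \<le> (\<Sum>s | s \<in> {..<T} \<rightarrow>\<^sub>E L \<and> weight l0 T s > m. ?P s * real (weight l0 T s))"
    by (intro sum_mono mult_left_mono) (auto intro!: P)
  also have "\<dots> \<le> (\<Sum>s\<in>{..<T} \<rightarrow>\<^sub>E L. ?P s * real (weight l0 T s))"
    by (rule sum_mono2) (use assms(1) P in \<open>auto intro: finite_PiE\<close>)
  also have "\<dots> = (\<Sum>s\<in>{..<T} \<rightarrow>\<^sub>E L. \<Sum>t<T. ?P s * (if s t \<noteq> l0 then 1 else 0))"
    by (intro sum.cong refl)
      (simp add: weight_def sum_distrib_left[symmetric] sum.If_cases Int_def)
  also have "\<dots> = (\<Sum>t<T. \<Sum>s\<in>{..<T} \<rightarrow>\<^sub>E L. ?P s * (if s t \<noteq> l0 then 1 else 0))"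
    by (rule sum.swap)
  also have "\<dots> = (\<Sum>t<T. 1 - p l0)"
  proof (rule sum.cong[OF refl])
    fix t assume t: "t \<in> {..<T}"
    \<comment> \<open>Zeroing the factor of \<open>l0\<close> at position \<open>t\<close> absorbs
      the indicator into the product, so the sum over words factorises.\<close>
    let ?f = "\<lambda>t' l. if t' = t \<and> l = l0 then 0 else p l"
    have "?P s * (if s t \<noteq> l0 then 1 else 0) = (\<Prod>t'<T. ?f t' (s t'))" for s
    proof (cases "s t = l0")
      case True
      then have "\<exists>t'\<in>{..<T}. ?f t' (s t') = 0" using t by auto
      then have "(\<Prod>t'<T. ?f t' (s t')) = 0" by (intro prod_zero) auto
      then show ?thesis using True by simp
    next
      case False
      then have "(\<Prod>t'<T. ?f t' (s t')) = ?P s" by (intro prod.cong) auto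
      then show ?thesis using False by simp
    qed
    then have "(\<Sum>s\<in>{..<T} \<rightarrow>\<^sub>E L. ?P s * (if s t \<noteq> l0 then 1 else 0)) = (\<Prod>t'<T. \<Sum>l\<in>L. ?f t' l)"
      using sum_PiE_prod[OF assms(1), of ?f T] by simp
    also have "\<dots> = (\<Prod>t'<T. if t' = t then 1 - p l0 else 1)"
    proof (rule prod.cong[OF refl])
      fix t'
      have "(\<Sum>l\<in>L. if l = l0 then 0 else p l) = (\<Sum>l\<in>L. p l - (if l = l0 then p l0 else 0))"
        by (rule sum.cong) auto
      then have "(\<Sum>l\<in>L. if l = l0 then 0 else p l) = 1 - p l0"
        using assms by (simp add: sum_subtractf)
      then show "(\<Sum>l\<in>L. ?f t' l) = (if t' = t then 1 - p l0 else 1)"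
        using p by auto
    qed
    finally show "(\<Sum>s\<in>{..<T} \<rightarrow>\<^sub>E L. ?P s * (if s t \<noteq> l0 then 1 else 0)) = 1 - p l0"
      using t by simp
  qed
  also have "\<dots> \<le> real T * \<epsilon>"
    using \<epsilon> by (simp add: mult_left_mono)
  finally show ?thesis
    by (simp add: pos_le_divide_eq add_pos_nonneg add_nonneg_pos)
qed

text \<open>The squared coefficients of a tensor power form a product distribution on words. Words
  of weight at most \<open>m\<close> serve as the shared vectors, and the others form the remainder,
  controlled by the tail bound. The cutoff \<open>m\<close> stays free.\<close>

lemma tensor_learning_bound:
  fixes e :: "'l \<Rightarrow> 'i \<Rightarrow> real" and \<beta> :: "'h \<Rightarrow> 'l \<Rightarrow> real"
  assumes povm: "povm (tensor_basis T I) H E"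
    and fin: "finite I" "finite H" "finite L" and "C \<subseteq> H" "l0 \<in> L"
    and on: "\<And>l l'. l \<in> L \<Longrightarrow> l' \<in> L \<Longrightarrow> (\<Sum>i\<in>I. e l i * e l' i) = (if l = l' then 1 else 0)"
    and v: "\<And>c i. c \<in> C \<Longrightarrow> i \<in> I \<Longrightarrow> v c i = of_real (\<Sum>l\<in>L. \<beta> c l * e l i)"
    and \<beta>: "\<And>c. c \<in> C \<Longrightarrow> (\<Sum>l\<in>L. (\<beta> c l)\<^sup>2) = 1" "\<And>c. c \<in> C \<Longrightarrow> 1 - (\<beta> c l0)\<^sup>2 \<le> \<epsilon>"
    and succ: "\<And>c. c \<in> C \<Longrightarrow> outcome_prob (tensor_basis T I) E (tensor_power T (v c)) c \<ge> p"
  shows "p * real (card C) \<le>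
    11/10 * (1 + real T * real (card L)) ^ m + 11 * (real T * \<epsilon> / (real m + 1)) * real (card C)"
proof -
  define S where "S = {..<T} \<rightarrow>\<^sub>E L"
  define W where "W = {s \<in> S. weight l0 T s \<le> m}"
  define W' where "W' = {s \<in> S. weight l0 T s > m}"
  define \<alpha> where "\<alpha> = (\<lambda>c s. \<Prod>t<T. \<beta> c (s t))"
  define b where "b = (\<lambda>s w. \<Prod>t<T. e (s t) (w t))"
  have finS: "finite S" and finB: "finite (tensor_basis T I)"
    using fin by (auto simp: S_def tensor_basis_def intro: finite_PiE)
  then have finW: "finite W" "finite W'" and W: "S = W \<union> W'" "W \<inter> W' = {}" "W \<subseteq> S" "W' \<subseteq> S"
    by (auto simp: W_def W'_def)
  have onb: "(\<Sum>w\<in>tensor_basis T I. b s w * b s' w) = (if s = s' then 1 else 0)"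
    if "s \<in> S" "s' \<in> S" for s s'
    unfolding b_def using tensor_orthonormal[OF fin(1) on] that by (simp add: S_def)
  have \<alpha>2: "(\<alpha> c s)\<^sup>2 = (\<Prod>t<T. (\<beta> c (s t))\<^sup>2)" for c s
    by (simp add: \<alpha>_def prod_power_distrib)
  have sum\<alpha>: "(\<Sum>s\<in>S. (\<alpha> c s)\<^sup>2) = 1" if "c \<in> C" for c
    unfolding \<alpha>2 S_def using sum_PiE_prod[OF fin(3), of "\<lambda>t l. (\<beta> c l)\<^sup>2" T] \<beta>(1)[OF that]
    by simp
  have "p * real (card C) \<le>
     (\<Sum>c\<in>C. outcome_prob (tensor_basis T I) E (tensor_power T (v c)) c)"
    using sum_mono[of C "\<lambda>c. p", OF succ] by (simp add: mult.commute)
  also have "\<dots> \<le> 11/10 * real (card W) + 11 * (real T * \<epsilon> / (real m + 1)) * real (card C)"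
  proof (rule sum_outcome_prob_le[OF povm finB fin(2) finW(1) \<open>C \<subseteq> H\<close>,
        where \<alpha> = \<alpha> and e = "\<lambda>s w. of_real (b s w)"
          and r = "\<lambda>c w. of_real (\<Sum>s\<in>W'. \<alpha> c s * b s w)"])
    fix c assume c: "c \<in> C"
    show "tensor_power T (v c) w = (\<Sum>s\<in>W. of_real (\<alpha> c s) * of_real (b s w)) +
        of_real (\<Sum>s\<in>W'. \<alpha> c s * b s w)" if "w \<in> tensor_basis T I" for w
      using tensor_power_expansion[OF fin(3) that v[OF c]] W finW
      by (simp add: \<alpha>_def b_def S_def[symmetric] sum.union_disjoint)
    show "(\<Sum>s\<in>W. (\<alpha> c s)\<^sup>2) \<le> 1"
      using sum_mono2[OF finS W(3), of "\<lambda>s. (\<alpha> c s)\<^sup>2"] sum\<alpha>[OF c] by simp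
    have "(\<Sum>w\<in>tensor_basis T I. (\<Sum>s\<in>W'. \<alpha> c s * b s w)\<^sup>2) = (\<Sum>s\<in>W'. (\<alpha> c s)\<^sup>2)"
      using W(4) by (intro orthonormal_sum_norm finW onb) auto
    also have "\<dots> \<le> real T * \<epsilon> / (real m + 1)"
      using weight_tail[OF fin(3) \<open>l0 \<in> L\<close>, of "\<lambda>l. (\<beta> c l)\<^sup>2"] \<beta>[OF c]
      by (simp add: \<alpha>2 W'_def S_def)
    finally show "(\<Sum>w\<in>tensor_basis T I. (cmod (of_real (\<Sum>s\<in>W'. \<alpha> c s * b s w)))\<^sup>2)
        \<le> real T * \<epsilon> / (real m + 1)"
      by (simp only: norm_of_real power2_abs)
  next
    fix s assume "s \<in> W"
    then have "s \<in> S" using W(3) by auto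
    then show "(\<Sum>w\<in>tensor_basis T I. (cmod (of_real (b s w)))\<^sup>2) \<le> 1"
      using onb[of s s] by (simp add: power2_eq_square)
  qed
  also have "real (card W) \<le> (1 + real T * real (card L)) ^ m"
    using card_weight_le[OF fin(3) \<open>l0 \<in> L\<close>, of T m]
    unfolding W_def S_def of_nat_le_iff[symmetric, where 'a = real] by simp
  finally show ?thesis by simp
qed

section \<open>Fourier analysis and indicators of linear graphs\<close>

definition chi :: "nat \<Rightarrow> (nat \<Rightarrow> nat) \<Rightarrow> (nat \<Rightarrow> nat) \<Rightarrow> real" where
  "chi n S x = (-1) ^ (\<Sum>i<n. S i * x i)"

text \<open>The zero vector must be undefined beyond the first \<open>n\<close> coordinates to
  belong to the extensional set \<open>cube n\<close>.\<close>

definition origin :: "nat \<Rightarrow> nat \<Rightarrow> nat" where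
  "origin n = (\<lambda>i\<in>{..<n}. 0)"

lemma finite_cube [simp]: "finite (cube n)"
  by (simp add: cube_def finite_PiE)

lemma card_cube: "card (cube n) = 2 ^ n"
  by (simp add: cube_def card_funcsetE numeral_2_eq_2)

lemma origin_in_cube [simp]: "origin n \<in> cube n"
  by (auto simp: origin_def cube_def)

lemma chi_prod: "chi n S x = (\<Prod>i<n. (-1) ^ (S i * x i))"
  by (simp add: chi_def power_sum)

lemma chi_commute: "chi n S x = chi n x S"
  by (simp add: chi_def mult.commute)

lemma chi_origin [simp]: "chi n (origin n) x = 1"
  by (simp add: chi_prod origin_def)

lemma fourier_coeff_chi: "fourier_coeff n f S = (\<Sum>x\<in>cube n. f x * chi n S x) / 2 ^ n"
  by (simp add: fourier_coeff_def chi_def)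

lemma chi_orthogonal:
  assumes "S \<in> cube n" "S' \<in> cube n"
  shows "(\<Sum>x\<in>cube n. chi n S x * chi n S' x) = (if S = S' then 2 ^ n else 0)"
proof -
  have "(\<Sum>x\<in>cube n. chi n S x * chi n S' x) =
        (\<Sum>x\<in>{..<n} \<rightarrow>\<^sub>E {0, 1}. \<Prod>i<n. (-1) ^ (S i * x i) * (-1) ^ (S' i * x i))"
    by (simp add: cube_def chi_prod prod.distrib)
  also have "\<dots> = (\<Prod>i<n. \<Sum>b\<in>{0, 1::nat}. (-1) ^ (S i * b) * (-1) ^ (S' i * b))"
    by (rule prod_sum_PiE[symmetric]) auto
  also have "\<dots> = (\<Prod>i<n. if S i = S' i then 2 else 0)"
  proof (rule prod.cong[OF refl])
    fix i assume "i \<in> {..<n}"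
    then have "S i = 0 \<or> S i = 1" "S' i = 0 \<or> S' i = 1"
      using assms by (auto simp: cube_def PiE_iff)
    then show "(\<Sum>b\<in>{0, 1::nat}. (-1) ^ (S i * b) * (-1) ^ (S' i * b)) =
        (if S i = S' i then 2 else 0 :: real)"
      by auto
  qed
  also have "\<dots> = (if S = S' then 2 ^ n else 0)"
  proof (cases "S = S'")
    case False
    then have "\<exists>i<n. S i \<noteq> S' i"
      using PiE_ext[of S "{..<n}" "\<lambda>_. {0, 1}" S'] assms by (auto simp: cube_def)
    then show ?thesis using False by auto
  qed simp
  finally show ?thesis .
qed

text \<open>Since characters are symmetric in frequency and point, their orthogonality also applies
  to sums over frequencies.\<close>

lemma fourier_inversion:
  assumes "x \<in> cube n"
  shows "(\<Sum>S\<in>cube n. fourier_coeff n f S * chi n S x) = f x"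
proof -
  have "(\<Sum>S\<in>cube n. fourier_coeff n f S * chi n S x) =
        (\<Sum>S\<in>cube n. \<Sum>y\<in>cube n. f y * (chi n y S * chi n x S) / 2 ^ n)"
    by (simp add: fourier_coeff_chi chi_commute[of n x] chi_commute[of n y S for y S]
        sum_distrib_right mult.assoc flip: sum_divide_distrib)
  also have "\<dots> = (\<Sum>y\<in>cube n. f y * (\<Sum>S\<in>cube n. chi n y S * chi n x S) / 2 ^ n)"
    by (subst sum.swap) (simp add: sum_distrib_left sum_divide_distrib)
  also have "\<dots> = (\<Sum>y\<in>cube n. if y = x then f y else 0)"
    by (rule sum.cong) (auto simp: chi_orthogonal assms)
  finally show ?thesis using assms by simp
qed

lemma fourier_parseval:
  "(\<Sum>S\<in>cube n. (fourier_coeff n f S)\<^sup>2) = (\<Sum>x\<in>cube n. (f x)\<^sup>2) / 2 ^ n"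
proof -
  have "(\<Sum>S\<in>cube n. (fourier_coeff n f S)\<^sup>2) =
        (\<Sum>S\<in>cube n. \<Sum>x\<in>cube n. fourier_coeff n f S * chi n S x * f x / 2 ^ n)"
    by (simp add: power2_eq_square fourier_coeff_chi[of n f S for S] sum_distrib_left
        sum_divide_distrib mult_ac)
  also have "\<dots> = (\<Sum>x\<in>cube n. (\<Sum>S\<in>cube n. fourier_coeff n f S * chi n S x) * f x / 2 ^ n)"
    by (subst sum.swap) (simp add: sum_distrib_right sum_divide_distrib)
  also have "\<dots> = (\<Sum>x\<in>cube n. (f x)\<^sup>2 / 2 ^ n)"
    by (simp add: fourier_inversion power2_eq_square)
  finally show ?thesis by (simp add: sum_divide_distrib)
qed

text \<open>Indices with equal frequency are added up, so the formula also covers maps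
  \<open>s\<close> that are not injective.\<close>

lemma fourier_coeff_combination:
  assumes f: "\<And>x. x \<in> cube n \<Longrightarrow> f x = (\<Sum>a\<in>A. w a * chi n (s a) x)"
    and s: "\<And>a. a \<in> A \<Longrightarrow> s a \<in> cube n" and S: "S \<in> cube n"
  shows "fourier_coeff n f S = (\<Sum>a\<in>A. if s a = S then w a else 0)"
proof -
  have "(\<Sum>x\<in>cube n. f x * chi n S x) = (\<Sum>x\<in>cube n. \<Sum>a\<in>A. w a * (chi n (s a) x * chi n S x))"
    by (simp add: f sum_distrib_right mult.assoc)
  also have "\<dots> = (\<Sum>a\<in>A. w a * (\<Sum>x\<in>cube n. chi n (s a) x * chi n S x))"
    by (subst sum.swap) (simp add: sum_distrib_left)
  also have "\<dots> = (\<Sum>a\<in>A. (if s a = S then w a else 0) * 2 ^ n)"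
    by (intro sum.cong refl) (simp add: chi_orthogonal s S)
  finally show ?thesis
    by (simp add: fourier_coeff_chi flip: sum_distrib_right)
qed

section \<open>Graphs of linear maps over GF(2)\<close>

definition matrices :: "nat \<Rightarrow> nat \<Rightarrow> (nat \<times> nat \<Rightarrow> nat) set" where
  "matrices n d = {..<d} \<times> {d..<n} \<rightarrow>\<^sub>E {0, 1}"

text \<open>The condition says that \<open>x\<close> lies on the graph of \<open>M\<close> over \<open>GF(2)\<close>, with the first \<open>d\<close>
  coordinates of \<open>x\<close> as values and the others as arguments.\<close>

definition graph_fun :: "nat \<Rightarrow> nat \<Rightarrow> (nat \<times> nat \<Rightarrow> nat) \<Rightarrow> (nat \<Rightarrow> nat) \<Rightarrow> real" where
  "graph_fun n d M = (\<lambda>x\<in>cube n.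
     if \<forall>i<d. even (x i + (\<Sum>j\<in>{d..<n}. M (i, j) * x j)) then -1 else 1)"

text \<open>The row vector \<open>a (I | M)\<close> over GF(2). For a 0/1 matrix, these vectors form
  the annihilator of the graph of \<open>M\<close>, where the Fourier transform of its indicator
  lives.\<close>

definition graph_freq :: "nat \<Rightarrow> nat \<Rightarrow> (nat \<times> nat \<Rightarrow> nat) \<Rightarrow> (nat \<Rightarrow> nat) \<Rightarrow> nat \<Rightarrow> nat" where
  "graph_freq n d M a = (\<lambda>j\<in>{..<n}. if j < d then a j else (\<Sum>i<d. a i * M (i, j)) mod 2)"

lemma card_matrices: "card (matrices n d) = 2 ^ (d * (n - d))"
  by (simp add: matrices_def card_funcsetE card_cartesian_product numeral_2_eq_2)

lemma graph_fun_bool: "graph_fun n d M \<in> bool_funs n"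
  by (auto simp: graph_fun_def bool_funs_def)

lemma graph_freq_in_cube:
  assumes "d \<le> n" "a \<in> cube d"
  shows "graph_freq n d M a \<in> cube n"
  using assms by (auto simp: graph_freq_def cube_def PiE_iff)

lemma minus_one_power_cong: "even a = even b \<Longrightarrow> (-1 :: real) ^ a = (-1) ^ b"
  by (simp add: minus_one_power_iff)

lemma even_sum_mod2:
  fixes f g :: "'a \<Rightarrow> nat"
  assumes "\<And>i. i \<in> A \<Longrightarrow> even (f i) = even (g i)"
  shows "even (sum f A) = even (sum g A)"
  using assms by (induction A rule: infinite_finite_induct) auto

lemma chi_graph_freq:
  assumes "d \<le> n"
  shows "chi n (graph_freq n d M a) x =
         (\<Prod>i<d. (-1) ^ (a i * (x i + (\<Sum>j\<in>{d..<n}. M (i, j) * x j))))"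
proof -
  have "(\<Sum>j<n. graph_freq n d M a j * x j) =
      (\<Sum>j<d. graph_freq n d M a j * x j) + (\<Sum>j\<in>{d..<n}. graph_freq n d M a j * x j)"
    using sum.atLeastLessThan_concat[of 0 d n "\<lambda>j. graph_freq n d M a j * x j"] assms
    by (simp add: atLeast0LessThan)
  also have "(\<Sum>j<d. graph_freq n d M a j * x j) = (\<Sum>j<d. a j * x j)"
    using assms by (intro sum.cong) (auto simp: graph_freq_def)
  finally have "even (\<Sum>j<n. graph_freq n d M a j * x j) =
      even ((\<Sum>j<d. a j * x j) + (\<Sum>j\<in>{d..<n}. graph_freq n d M a j * x j))"
    by simp
  also have "\<dots> = even ((\<Sum>j<d. a j * x j) + (\<Sum>j\<in>{d..<n}. (\<Sum>i<d. a i * M (i, j)) * x j))"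
    using even_sum_mod2[of "{d..<n}" "\<lambda>j. graph_freq n d M a j * x j"
        "\<lambda>j. (\<Sum>i<d. a i * M (i, j)) * x j"]
    by (simp add: graph_freq_def)
  also have "(\<Sum>j\<in>{d..<n}. (\<Sum>i<d. a i * M (i, j)) * x j) =
      (\<Sum>i<d. a i * (\<Sum>j\<in>{d..<n}. M (i, j) * x j))"
    unfolding sum_distrib_left sum_distrib_right by (subst sum.swap) (simp add: mult.assoc)
  also have "(\<Sum>j<d. a j * x j) + \<dots> = (\<Sum>i<d. a i * (x i + (\<Sum>j\<in>{d..<n}. M (i, j) * x j)))"
    by (simp add: distrib_left sum.distrib)
  finally show ?thesis
    unfolding chi_def power_sum[symmetric] by (rule minus_one_power_cong)
qed

text \<open>The sum over \<open>a\<close> factorises into terms \<open>1 + (-1)^e\<close> with one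
  parity check \<open>e\<close> per row. It is \<open>2^d\<close> on the graph and 0 elsewhere, and
  the function is 1 minus twice the indicator.\<close>

lemma graph_fun_expansion:
  assumes "d \<le> n" "x \<in> cube n"
  shows "graph_fun n d M x = 1 - 2 / 2 ^ d * (\<Sum>a\<in>cube d. chi n (graph_freq n d M a) x)"
proof -
  let ?e = "\<lambda>i. x i + (\<Sum>j\<in>{d..<n}. M (i, j) * x j)"
  have "(\<Sum>a\<in>cube d. chi n (graph_freq n d M a) x) =
        (\<Prod>i<d. \<Sum>b\<in>{0, 1::nat}. (-1) ^ (b * ?e i))"
    unfolding chi_graph_freq[OF assms(1)] cube_def by (rule prod_sum_PiE[symmetric]) auto
  also have "\<dots> = (\<Prod>i<d. if even (?e i) then 2 else 0)"
    by (intro prod.cong refl) (simp add: minus_one_power_iff)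
  also have "\<dots> = (if \<forall>i<d. even (?e i) then 2 ^ d else 0)"
    by auto
  finally show ?thesis
    using assms(2) by (auto simp: graph_fun_def)
qed

lemma inj_graph_freq: "d \<le> n \<Longrightarrow> inj_on (graph_freq n d M) (cube d)"
proof (rule inj_onI)
  fix a b assume *: "d \<le> n" "a \<in> cube d" "b \<in> cube d" "graph_freq n d M a = graph_freq n d M b"
  have "a i = b i" if "i < d" for i
    using fun_cong[OF *(4), of i] that *(1) by (simp add: graph_freq_def)
  then show "a = b"
    using *(2,3) by (intro PiE_ext[of a "{..<d}" "\<lambda>_. {0, 1}" b]) (auto simp: cube_def)
qed

lemma graph_freq_origin: "d \<le> n \<Longrightarrow> graph_freq n d M (origin d) = origin n"
  by (auto simp: graph_freq_def origin_def fun_eq_iff)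

text \<open>The constant 1 of the expansion is the character at the origin, whence the extra weight
  at \<open>origin d\<close>.\<close>

lemma graph_fun_fourier:
  assumes "d \<le> n" "S \<in> cube n"
  shows "fourier_coeff n (graph_fun n d M) S =
    (\<Sum>a\<in>cube d. if graph_freq n d M a = S then (if a = origin d then 1 else 0) - 2 / 2 ^ d else 0)"
proof (rule fourier_coeff_combination)
  fix x assume x: "x \<in> cube n"
  have "(\<Sum>a\<in>cube d. ((if a = origin d then 1 else 0) - 2 / 2 ^ d) * chi n (graph_freq n d M a) x)
     = (\<Sum>a\<in>cube d. (if a = origin d then 1 else 0) * chi n (graph_freq n d M a) x)
       - 2 / 2 ^ d * (\<Sum>a\<in>cube d. chi n (graph_freq n d M a) x)"
    by (simp only: left_diff_distrib sum_subtractf sum_distrib_left)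
  also have "(\<Sum>a\<in>cube d. (if a = origin d then 1 else 0) * chi n (graph_freq n d M a) x)
     = (\<Sum>a\<in>cube d. if a = origin d then 1 else 0)"
    by (intro sum.cong refl) (simp add: graph_freq_origin assms)
  also have "\<dots> = 1" by simp
  finally show "graph_fun n d M x =
      (\<Sum>a\<in>cube d. ((if a = origin d then 1 else 0) - 2 / 2 ^ d) * chi n (graph_freq n d M a) x)"
    using graph_fun_expansion[OF assms(1) x] by simp
qed (use assms graph_freq_in_cube in auto)

text \<open>By injectivity of the frequencies only \<open>origin d\<close> contributes. The value is
  independent of \<open>M\<close>, which gives all the examples a large common component.\<close>

lemma graph_fun_fourier_origin:
  assumes "d \<le> n"
  shows "fourier_coeff n (graph_fun n d M) (origin n) = 1 - 2 / 2 ^ d"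
proof -
  have "fourier_coeff n (graph_fun n d M) (origin n) =
      (\<Sum>a\<in>cube d. if a = origin d then 1 - 2 / 2 ^ d else 0)"
    unfolding graph_fun_fourier[OF assms origin_in_cube]
  proof (rule sum.cong[OF refl])
    fix a assume "a \<in> cube d"
    then have "graph_freq n d M a = origin n \<longleftrightarrow> a = origin d"
      using inj_onD[OF inj_graph_freq[OF assms, of M], of a "origin d"] graph_freq_origin[OF assms]
      by auto
    then show "(if graph_freq n d M a = origin n then (if a = origin d then 1 else 0) - 2 / 2 ^ d
        else (0 :: real)) = (if a = origin d then 1 - 2 / 2 ^ d else 0)"
      by simp
  qed
  then show ?thesis by simp
qed

lemma graph_fun_sparse:
  assumes "d \<le> n" "2 ^ d \<le> k"
  shows "graph_fun n d M \<in> fourier_sparse n k"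
proof -
  have "{S \<in> cube n. fourier_coeff n (graph_fun n d M) S \<noteq> 0} \<subseteq> graph_freq n d M ` cube d"
  proof clarify
    fix S assume S: "S \<in> cube n" "fourier_coeff n (graph_fun n d M) S \<noteq> 0"
    then obtain a where "a \<in> cube d" "graph_freq n d M a = S"
      unfolding graph_fun_fourier[OF assms(1) S(1)]
      by (elim sum.not_neutral_contains_not_neutral) (simp split: if_splits)
    then show "S \<in> graph_freq n d M ` cube d" by auto
  qed
  from card_mono[OF _ this] have "card {S \<in> cube n. fourier_coeff n (graph_fun n d M) S \<noteq> 0}
      \<le> card (graph_freq n d M ` cube d)"
    by simp
  also have "\<dots> \<le> k"
    using card_image_le[OF finite_cube, of "graph_freq n d M" d] assms(2) by (simp add: card_cube)
  finally show ?thesis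
    by (simp add: fourier_sparse_def graph_fun_bool)
qed

lemma inj_graph_fun: "d \<le> n \<Longrightarrow> inj_on (graph_fun n d) (matrices n d)"
proof (rule inj_onI)
  fix M N assume d: "d \<le> n" and MN: "M \<in> matrices n d" "N \<in> matrices n d"
    and eq: "graph_fun n d M = graph_fun n d N"
  have bit: "K (i, j) = 0 \<or> K (i, j) = 1" if "K \<in> matrices n d" "i < d" "j \<in> {d..<n}" for K i j
    using that by (auto simp: matrices_def PiE_iff)
  show "M = N"
  proof (rule PiE_ext[OF MN[unfolded matrices_def]])
    fix ij assume "ij \<in> {..<d} \<times> {d..<n}"
    then obtain i j where ij: "i \<in> {..<d}" "j \<in> {d..<n}" and ij_eq: "ij = (i, j)" by auto
    \<comment> \<open>The point of the graph of \<open>M\<close> above the unit vector at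
      \<open>j\<close>; its value is column \<open>j\<close> of \<open>M\<close>. Lying on the graph
      of \<open>N\<close> as well forces the two columns to agree.\<close>
    define x where "x = (\<lambda>l\<in>{..<n}. if l < d then M (l, j) else if l = j then 1 else 0)"
    have x: "x \<in> cube n"
      using bit[OF MN(1)] ij by (auto simp: x_def cube_def)
    have "(\<Sum>l\<in>{d..<n}. K (i', l) * x l) = (\<Sum>l\<in>{d..<n}. if l = j then K (i', l) else 0)"
      for K and i' :: nat
      by (intro sum.cong refl) (auto simp: x_def)
    then have sum: "x i' + (\<Sum>l\<in>{d..<n}. K (i', l) * x l) = M (i', j) + K (i', j)"
      if "i' < d" for K i'
      using ij that d by (simp add: x_def)
    have "\<forall>i'<d. even (x i' + (\<Sum>l\<in>{d..<n}. M (i', l) * x l))"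
    proof (intro allI impI)
      fix i' assume "i' < d"
      then show "even (x i' + (\<Sum>l\<in>{d..<n}. M (i', l) * x l))" by (simp add: sum)
    qed
    then have "graph_fun n d M x = -1"
      using x by (simp add: graph_fun_def)
    then have "graph_fun n d N x = -1" using eq by simp
    then have "even (x i + (\<Sum>l\<in>{d..<n}. N (i, l) * x l))"
      using x ij by (auto simp: graph_fun_def split: if_splits)
    then have "even (M (i, j) + N (i, j))"
      using ij by (simp only: sum lessThan_iff)
    then show "M ij = N ij"
      unfolding ij_eq using bit[OF MN(1), of i j] bit[OF MN(2), of i j] ij by auto
  qed
qed

section \<open>Learning from quantum examples\<close>

lemma finite_bool_funs: "finite (bool_funs n)"
  by (simp add: bool_funs_def finite_PiE)

text \<open>For signs, \<open>(1 + b * c x) / 2\<close> is the indicator of \<open>b = c x\<close>.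
  This form is affine in \<open>c x\<close>, ready for the Fourier expansion.\<close>

lemma quantum_example_eq:
  assumes "c \<in> bool_funs n" "x \<in> cube n" "b \<in> {-1, 1}"
  shows "quantum_example n c (x, b) = of_real ((1 + b * c x) / (2 * sqrt (2 ^ n)))"
proof -
  have "(\<Sum>y\<in>cube n. ket (y, c y) (x, b)) = (\<Sum>y\<in>cube n. if y = x then (if b = c x then 1 else 0) else 0)"
    by (rule sum.cong) (auto simp: ket_def)
  also have "\<dots> = (if b = c x then 1 else 0)"
    using assms(2) by simp
  also have "\<dots> = complex_of_real ((1 + b * c x) / 2)"
  proof -
    have "c x = -1 \<or> c x = 1" using assms by (auto simp: bool_funs_def PiE_iff)
    then show ?thesis using assms(3) by (elim disjE insertE) simp_all
  qed
  finally show ?thesis unfolding quantum_example_def by (simp only: of_real_mult[symmetric]) simp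
qed

section \<open>An orthonormal alphabet for quantum examples\<close>

text \<open>In the basis \<open>|S,\<plusminus>\<rangle>\<close> obtained from the characters, an example for \<open>c\<close>
  with Fourier coefficients \<open>c\<^sub>S\<close> is
  \<open>(|0,+\<rangle> + (\<Sum>S. c\<^sub>S |S,-\<rangle>)) / \<surd>2\<close>. When all concepts have the same zeroth coefficient \<open>q\<close>,
  the part \<open>|0,+\<rangle> + q |0,-\<rangle>\<close> is common to all of them; normalised, it serves as the letter at \<open>S = 0\<close>.\<close>

definition letter :: "nat \<Rightarrow> real \<Rightarrow> (nat \<Rightarrow> nat) \<Rightarrow> example_label \<Rightarrow> real" where
  "letter n q S = (\<lambda>(x, b).
     (if S = origin n then (1 + q * b) / sqrt (1 + q\<^sup>2) else b * chi n S x) / sqrt (2 * 2 ^ n))"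

definition amplitude :: "nat \<Rightarrow> real \<Rightarrow> ((nat \<Rightarrow> nat) \<Rightarrow> real) \<Rightarrow> (nat \<Rightarrow> nat) \<Rightarrow> real" where
  "amplitude n q c S = (if S = origin n then sqrt (1 + q\<^sup>2) else fourier_coeff n c S) / sqrt 2"

lemma letter_orthonormal:
  assumes "S \<in> cube n" "S' \<in> cube n"
  shows "(\<Sum>i\<in>example_basis n. letter n q S i * letter n q S' i) = (if S = S' then 1 else 0)"
proof -
  let ?r = "sqrt (1 + q\<^sup>2)"
  \<comment> \<open>The mean over both signs \<open>b\<close> of the product of the sign factors. In
    the mixed case orthogonality of the characters removes it.\<close>
  define g where "g = (if S = origin n \<and> S' = origin n then 1
    else if S = origin n \<or> S' = origin n then q / ?r else 1)"
  have pos: "1 + q\<^sup>2 > 0" by (simp add: add_pos_nonneg)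
  have sq: "((1 + q)\<^sup>2 + (1 - q)\<^sup>2) / (1 + q\<^sup>2) = 2"
    using pos by (simp add: field_simps power2_eq_square)
  have "letter n q S (x, -1) * letter n q S' (x, -1) + letter n q S (x, 1) * letter n q S' (x, 1)
      = g * (chi n S x * chi n S' x) / 2 ^ n" for x
  proof (cases "S = origin n"; cases "S' = origin n")
    assume [simp]: "S = origin n" "S' = origin n"
    have "u / ?r / sqrt (2 * 2 ^ n) * (u / ?r / sqrt (2 * 2 ^ n)) = u\<^sup>2 / (1 + q\<^sup>2) / (2 * 2 ^ n)" for u
      unfolding power2_eq_square[symmetric] power_divide by simp
    then have "letter n q S (x, -1) * letter n q S' (x, -1) + letter n q S (x, 1) * letter n q S' (x, 1)
        = ((1 + q)\<^sup>2 + (1 - q)\<^sup>2) / (1 + q\<^sup>2) / (2 * 2 ^ n)"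
      by (simp add: letter_def add_divide_distrib[symmetric] del: divide_divide_eq_left)
    then show ?thesis unfolding sq by (simp add: g_def)
  qed (simp_all add: letter_def g_def algebra_simps add_divide_distrib diff_divide_distrib)
  then have "(\<Sum>i\<in>example_basis n. letter n q S i * letter n q S' i) =
      (\<Sum>x\<in>cube n. g * (chi n S x * chi n S' x) / 2 ^ n)"
    by (simp add: example_basis_def sum.cartesian_product' flip: sum.cartesian_product)
  also have "\<dots> = g * (\<Sum>x\<in>cube n. chi n S x * chi n S' x) / 2 ^ n"
    by (simp add: sum_distrib_left sum_divide_distrib)
  also have "\<dots> = (if S = S' then 1 else 0)"
    by (simp add: chi_orthogonal assms g_def)
  finally show ?thesis .
qed

text \<open>The factors \<open>sqrt (1 + q\<^sup>2)\<close> cancel between amplitude and letter, and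
  Fourier inversion sums the rest to \<open>1 + b * c x\<close>.\<close>

lemma quantum_example_expansion:
  assumes c: "c \<in> bool_funs n" and q: "fourier_coeff n c (origin n) = q"
    and i: "i \<in> example_basis n"
  shows "quantum_example n c i = of_real (\<Sum>S\<in>cube n. amplitude n q c S * letter n q S i)"
proof -
  obtain x b where i_eq: "i = (x, b)" and x: "x \<in> cube n" and b: "b \<in> {-1, 1}"
    using i by (auto simp: example_basis_def)
  have pos: "1 + q\<^sup>2 > 0" by (simp add: add_pos_nonneg)
  have "amplitude n q c S * letter n q S i =
      ((if S = origin n then 1 else 0) + b * (fourier_coeff n c S * chi n S x)) / (2 * sqrt (2 ^ n))"
    for S
    using pos q by (simp add: amplitude_def letter_def i_eq real_sqrt_mult mult_ac)
  then have "(\<Sum>S\<in>cube n. amplitude n q c S * letter n q S i) =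
      ((\<Sum>S\<in>cube n. if S = origin n then 1 else 0)
        + b * (\<Sum>S\<in>cube n. fourier_coeff n c S * chi n S x)) / (2 * sqrt (2 ^ n))"
    by (simp only: sum.distrib sum_distrib_left sum_divide_distrib[symmetric])
  also have "\<dots> = (1 + b * c x) / (2 * sqrt (2 ^ n))"
    by (simp add: fourier_inversion x)
  finally show ?thesis
    using quantum_example_eq[OF c x b] i_eq by simp
qed

lemma amplitude_normalised:
  assumes c: "c \<in> bool_funs n" and q: "fourier_coeff n c (origin n) = q"
  shows "(\<Sum>S\<in>cube n. (amplitude n q c S)\<^sup>2) = 1"
proof -
  have "(\<Sum>S\<in>cube n. (amplitude n q c S)\<^sup>2) =
      (\<Sum>S\<in>cube n. ((if S = origin n then 1 else 0) + (fourier_coeff n c S)\<^sup>2) / 2)"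
    using q by (intro sum.cong refl) (simp add: amplitude_def power_divide)
  also have "\<dots> = (1 + (\<Sum>S\<in>cube n. (fourier_coeff n c S)\<^sup>2)) / 2"
    by (simp add: sum.distrib flip: sum_divide_distrib)
  also have "(\<Sum>S\<in>cube n. (fourier_coeff n c S)\<^sup>2) = (\<Sum>x\<in>cube n. 1) / 2 ^ n"
  proof -
    have "(c x)\<^sup>2 = 1" if "x \<in> cube n" for x
    proof -
      have "c x = -1 \<or> c x = 1" using c that by (auto simp: bool_funs_def PiE_iff)
      then show ?thesis by auto
    qed
    then show ?thesis by (simp add: fourier_parseval)
  qed
  finally show ?thesis by (simp add: card_cube)
qed

section \<open>Lower bound on the number of examples\<close>

text \<open>The distinguished letter is the origin. Its squared amplitude is
  \<open>(1 + q\<^sup>2) / 2\<close> for every concept, leaving \<open>(1 - q\<^sup>2) / 2\<close>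
  for the other letters.\<close>

lemma quantum_learner_bound:
  assumes learner: "quantum_learner n T E" and C: "C \<subseteq> bool_funs n"
    and q: "\<And>c. c \<in> C \<Longrightarrow> fourier_coeff n c (origin n) = q"
    and learns: "exactly_learns n T E C p"
  shows "p * real (card C) \<le> 11/10 * (1 + real T * 2 ^ n) ^ m
    + 11 * (real T * ((1 - q\<^sup>2) / 2) / (real m + 1)) * real (card C)"
proof -
  have "p * real (card C) \<le> 11/10 * (1 + real T * real (card (cube n))) ^ m
    + 11 * (real T * ((1 - q\<^sup>2) / 2) / (real m + 1)) * real (card C)"
  proof (rule tensor_learning_bound[OF learner[unfolded quantum_learner_def] _ finite_bool_funs
        finite_cube C origin_in_cube letter_orthonormal,
        where v = "quantum_example n" and \<beta> = "amplitude n q"])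
    fix c assume c: "c \<in> C"
    then have cb: "c \<in> bool_funs n" using C by auto
    show "quantum_example n c i = of_real (\<Sum>S\<in>cube n. amplitude n q c S * letter n q S i)"
      if "i \<in> example_basis n" for i
      by (rule quantum_example_expansion[OF cb q[OF c] that])
    show "(\<Sum>S\<in>cube n. (amplitude n q c S)\<^sup>2) = 1"
      by (rule amplitude_normalised[OF cb q[OF c]])
    show "1 - (amplitude n q c (origin n))\<^sup>2 \<le> (1 - q\<^sup>2) / 2"
      by (simp add: amplitude_def power_divide field_simps)
    show "p \<le> outcome_prob (tensor_basis T (example_basis n)) E (tensor_power T (quantum_example n c)) c"
      using learns c by (simp add: exactly_learns_def)
  qed (auto simp: example_basis_def)
  then show ?thesis by (simp add: card_cube)
qed

text \<open>By \<open>few\<close>, low-weight words account for success at most 11/20 on average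
  over the graph functions, so the tail must supply the rest of 2/3.\<close>

lemma sparse_learner_bound:
  assumes learner: "quantum_learner n T E"
    and learns: "exactly_learns n T E (fourier_sparse n k) (2/3)"
    and d: "d \<le> n" "2 ^ d \<le> k"
    and few: "2 * (1 + real T * 2 ^ n) ^ m \<le> 2 ^ (d * (n - d))"
  shows "real m + 1 < 200 * real T / 2 ^ d"
proof -
  define C where "C = graph_fun n d ` matrices n d"
  define N :: real where "N = 2 ^ (d * (n - d))"
  define \<epsilon> :: real where "\<epsilon> = (1 - (1 - 2 / 2 ^ d)\<^sup>2) / 2"
  have card: "real (card C) = N"
    unfolding C_def using card_image[OF inj_graph_fun[OF d(1)]] card_matrices[of n d]
    by (simp add: N_def)
  have N: "N > 0" by (simp add: N_def)
  have "C \<subseteq> fourier_sparse n k"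
    unfolding C_def using graph_fun_sparse[OF d] by auto
  then have "exactly_learns n T E C (2/3)"
    using learns by (auto simp: exactly_learns_def)
  moreover have "C \<subseteq> bool_funs n"
    unfolding C_def using graph_fun_bool by auto
  moreover have "fourier_coeff n c (origin n) = 1 - 2 / 2 ^ d" if "c \<in> C" for c
    using that graph_fun_fourier_origin[OF d(1)] by (auto simp: C_def)
  ultimately have "2/3 * N \<le> 11/10 * (1 + real T * 2 ^ n) ^ m
      + 11 * (real T * \<epsilon> / (real m + 1)) * N"
    using quantum_learner_bound[OF learner, of C "1 - 2 / 2 ^ d" "2/3" m] by (simp add: card \<epsilon>_def)
  also have "(1 + real T * 2 ^ n) ^ m \<le> N / 2"
    using few by (simp add: N_def)
  finally have "N * (2/3) \<le> N * (11/20 + 11 * (real T * \<epsilon> / (real m + 1)))"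
    by (simp add: algebra_simps)
  then have "2/3 \<le> 11/20 + 11 * (real T * \<epsilon> / (real m + 1))"
    using N by (simp only: mult_le_cancel_left_pos)
  \<comment> \<open>The gap 2/3 - 11/20 = 7/60, divided by 11, is 7/660, which exceeds
    1/100.\<close>
  then have 1: "1/100 < real T * \<epsilon> / (real m + 1)" by linarith
  have "\<epsilon> = 2 / 2 ^ d - 2 / (2 ^ d)\<^sup>2"
    by (simp add: \<epsilon>_def field_simps power2_eq_square)
  then have "\<epsilon> \<le> 2 / 2 ^ d" by simp
  then have "real T * \<epsilon> \<le> real T * (2 / 2 ^ d)" by (rule mult_left_mono) simp
  moreover have "(real m + 1) / 100 < real T * \<epsilon>"
    using 1 by (simp add: field_simps)
  ultimately show ?thesis by simp
qed

theorem theorem8: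
  fixes \<gamma> :: real
  assumes "0 < \<gamma>" and "\<gamma> < 1"
  shows "\<exists>a>0. \<forall>n k :: nat. n > 0 \<longrightarrow> 1 \<le> k \<longrightarrow> real k \<le> 2 powr (\<gamma> * real n) \<longrightarrow>
           (\<forall>T E. quantum_learner n T E \<longrightarrow> exactly_learns n T E (fourier_sparse n k) (2/3) \<longrightarrow>
              a * real k * log 2 (real k) \<le> real T)"
proof (intro exI[of _ "(1 - \<gamma>) / 4000"] conjI allI impI)
  show "0 < (1 - \<gamma>) / 4000" using assms by simp
  fix n k T :: nat and E
  assume n: "n > 0" and k: "1 \<le> k" "real k \<le> 2 powr (\<gamma> * real n)"
    and learner: "quantum_learner n T E" "exactly_learns n T E (fourier_sparse n k) (2/3)"
  \<comment> \<open>Chosen so that \<open>200 * ?a * (2 * 2^d) * (2 * d)\<close> equals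
    \<open>(1 - \<gamma>) * d / 5 * 2^d\<close>, which the choice of \<open>m\<close> below
    contradicts.\<close>
  let ?a = "(1 - \<gamma>) / 4000"
  show "?a * real k * log 2 (real k) \<le> real T"
  proof (rule ccontr)
    assume "\<not> ?thesis"
    then have T: "real T < ?a * real k * log 2 (real k)" by simp
    \<comment> \<open>For \<open>k = 1\<close> the logarithm vanishes and \<open>T\<close> would be
      negative.\<close>
    have "k \<noteq> 1" using T by auto
    then have k2: "k \<ge> 2" using k by simp
    obtain d where d: "2 ^ d \<le> k" "k < 2 ^ (d + 1)"
      using ex_power_ivl1[of 2 k] k by auto
    have "d \<noteq> 0"
    proof
      assume "d = 0"
      then show False using d k2 by simp
    qed
    then have d1: "real d \<ge> 1" by simp
    have log_le: "log 2 (real k) \<le> \<gamma> * real n"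
      using k by (simp add: log_le_iff)
    have log_ge: "real d \<le> log 2 (real k)"
      using d(1) k2 by (intro le_log_of_power) (simp_all flip: of_nat_le_iff)
    have log_less: "log 2 (real k) < real d + 1"
    proof -
      have "real k < 2 ^ (d + 1)"
        using d(2) unfolding of_nat_less_iff[symmetric, where 'a = real] by simp
      then show ?thesis using log_of_power_less[of k 2 "d + 1"] k2 by simp
    qed
    have \<gamma>n: "\<gamma> * real n < real n" using assms n by simp
    have dn: "d < n" using log_le log_ge \<gamma>n by simp
    \<comment> \<open>Here the upper bound on \<open>k\<close> enters: it keeps the exponent
      \<open>d * (n - d)\<close> of the family size at least
      \<open>(1 - \<gamma>) * d * n\<close>.\<close>
    have nd: "(1 - \<gamma>) * real n \<le> real (n - d)"
      using log_le log_ge dn by (simp add: of_nat_diff algebra_simps)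
    \<comment> \<open>Each of the \<open>m\<close> factors costs \<open>4 * n\<close> bits; dividing
      by 5 instead of 4 leaves room for the factor 2 in the counting condition.\<close>
    define m where "m = nat \<lfloor>(1 - \<gamma>) * real d / 5\<rfloor>"
    have "0 \<le> (1 - \<gamma>) * real d / 5" using assms by simp
    then have m: "real m \<le> (1 - \<gamma>) * real d / 5" "(1 - \<gamma>) * real d / 5 < real m + 1"
      unfolding m_def by linarith+
    \<comment> \<open>A crude bound from the contrary assumption suffices, since \<open>T\<close>
      enters the word count only through its logarithm.\<close>
    have "T \<le> 2 ^ (2 * n)"
    proof -
      have "real k \<le> 2 powr real n"
        using k(2) \<gamma>n by (meson less_imp_le order_trans powr_mono one_le_numeral)
      then have "real k \<le> 2 ^ n" by (simp add: powr_realpow)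
      moreover have "log 2 (real k) \<le> 2 ^ n"
        using log_le \<gamma>n of_nat_less_two_power[of n, where 'a = real] by linarith
      ultimately have "real k * log 2 (real k) \<le> 2 ^ n * 2 ^ n"
        using log_ge d1 by (intro mult_mono) auto
      moreover have "?a * (real k * log 2 (real k)) \<le> 1 * (real k * log 2 (real k))"
        using assms log_ge d1 by (intro mult_right_mono) auto
      ultimately have "real T \<le> 2 ^ n * 2 ^ n" using T by simp
      then have "real T \<le> real (2 ^ (2 * n))" by (simp add: mult_2 power_add)
      then show ?thesis by (simp only: of_nat_le_iff)
    qed
    have "1 + T * 2 ^ n \<le> 1 + 2 ^ (2 * n) * 2 ^ n"
      using \<open>T \<le> 2 ^ (2 * n)\<close> by simp
    also have "\<dots> \<le> 2 * 2 ^ (3 * n)"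
      by (simp add: power_add[symmetric])
    also have "\<dots> \<le> 2 ^ n * 2 ^ (3 * n)"
      using n by (intro mult_right_mono self_le_power) auto
    finally have "1 + T * 2 ^ n \<le> 2 ^ (4 * n)"
      by (simp add: power_add[symmetric])
    then have "2 * (1 + T * 2 ^ n) ^ m \<le> 2 * (2 ^ (4 * n)) ^ m"
      by (intro mult_left_mono power_mono) auto
    also have "\<dots> = 2 ^ (1 + 4 * n * m)"
      by (simp add: power_mult)
    \<comment> \<open>For small \<open>d\<close> the floor may be 0, and then
      \<open>0 < d < n\<close> suffices; otherwise \<open>n * m\<close> is at least 1 and pays for
      the summand 1.\<close>
    also have "1 + 4 * n * m \<le> d * (n - d)"
    proof (cases "m = 0")
      case True
      then show ?thesis using \<open>d \<noteq> 0\<close> dn by (simp add: Suc_le_eq)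
    next
      case False
      have "5 * real n * real m \<le> real n * ((1 - \<gamma>) * real d)"
        using m(1) mult_left_mono[of "5 * real m" "(1 - \<gamma>) * real d" "real n"] by simp
      also have "\<dots> = real d * ((1 - \<gamma>) * real n)" by simp
      also have "\<dots> \<le> real d * real (n - d)"
        using nd by (rule mult_left_mono) simp
      finally have "real (5 * n * m) \<le> real (d * (n - d))" by simp
      then have "5 * n * m \<le> d * (n - d)" by (simp only: of_nat_le_iff)
      moreover have "1 \<le> n * m" using n False by (simp add: Suc_le_eq)
      ultimately show ?thesis unfolding mult.assoc by linarith
    qed
    then have "(2 :: nat) ^ (1 + 4 * n * m) \<le> 2 ^ (d * (n - d))"
      by (rule power_increasing) simp
    finally have "2 * (1 + T * 2 ^ n) ^ m \<le> 2 ^ (d * (n - d))" .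
    then have "2 * (1 + real T * 2 ^ n) ^ m \<le> 2 ^ (d * (n - d))"
      unfolding of_nat_le_iff[symmetric, where 'a = real] by simp
    then have "real m + 1 < 200 * real T / 2 ^ d"
      using sparse_learner_bound[OF learner] d dn by simp
    then have "(real m + 1) * 2 ^ d < 200 * real T"
      by (simp add: field_simps)
    also have "\<dots> < 200 * (?a * real k * log 2 (real k))"
      using T by linarith
    \<comment> \<open>From \<open>k < 2^(d+1)\<close>, and \<open>log 2 k < d + 1\<close>, which is
      at most \<open>2 * d\<close> because \<open>d\<close> is positive.\<close>
    also have "\<dots> \<le> 200 * (?a * (2 * 2 ^ d) * (2 * real d))"
    proof -
      have "real k \<le> 2 * 2 ^ d"
        using d(2) unfolding of_nat_less_iff[symmetric, where 'a = real] by simp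
      then show ?thesis
        using log_ge log_less d1 assms by (intro mult_left_mono mult_mono) auto
    qed
    also have "\<dots> = ((1 - \<gamma>) * real d / 5) * 2 ^ d" by simp
    also have "\<dots> < (real m + 1) * 2 ^ d"
      using m(2) by simp
    finally show False .
  qed
qed

end
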